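(* Let $a>0$ and $a\le2\sigma$. Let $\hat\eta^+$ be the selector with components $\hat\eta^+_j=I\bigl(\frac1n\sum_{i=1}^nZ^i_j\ge\tau\bigr)$, $j=1,\dots,d$. If $\tau$ is chosen such that $\tau<2p(2)a/\sigma$, then for all $\theta\in\Theta_d^+(s,a)$, $$\mathbb{E}\Bigl[\tfrac1s|\hat\eta^+-\eta|\Bigr]\le\frac{d-|S|}{s}\exp\Bigl(-\frac{n\tau^2}{2B^2}\Bigr)+\frac{|S|}{s}\exp\Bigl(-\frac{n(2p(2)a/\sigma-\tau)^2}{2B^2}\Bigr),$$ where $S$ denotes the support of $\theta$.
   Context: Model: $\sigma>0$, $\alpha>0$, $n\ge1$, $1\le s\le d$, $\theta\in\mathbb{R}^d$; $X^1,\dots,X^n$ are i.i.d. random vectors in $\mathbb{R}^d$, $X^i=\theta+\sigma\xi^i$, where $\xi^i$ has i.i.d. coordinates whose common law on $\mathbb{R}$ is symmetric around $0$, has variance $1$ and is $c$-strongly log-concave for a constant $c>0$: it has density $p(x)=\exp(-\phi_0(x))\exp(-cx^2/2)$ with $\phi_0:\mathbb{R}\to\mathbb{R}$ a finite even convex function. $p(2)$ is the value of this density at $2$. $\Theta_d^+(s,a)$ is the set of $\theta\in\mathbb{R}^d$ for which there is $S\subseteq\{1,\dots,d\}$ with at most $s$ elements such that $\theta_j\ge a$ for $j\in S$ and $\theta_j=0$ for $j\notin S$. Put $\eta=(I(\theta_j\ne0))_{j=1,\dots,d}$, with $I(\cdot)$ the indicator function, and $|\hat\eta-\eta|=\sum_{j=1}^d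 I(\hat\eta_j\neq\eta_j)$ (Hamming loss). Privatized data (coordinate global mechanism). Let $\mathrm{sgn}[x]=1$ for $x\ge0$, $-1$ for $x<0$, and $\tilde X^i=(\mathrm{sgn}[X^i_j])_{j=1,\dots,d}$. Let $$B=\frac{e^\alpha+1}{e^\alpha-1}K_d,\qquad \frac1{K_d}=\begin{cases}\frac1{2^{d-1}}\binom{d-1}{\frac{d-1}2}& d\text{ odd},\\[2pt] \frac{(d-2)!\,(d-2)}{2^{d-1}(\frac d2-1)!\,\frac d2!}& d\text{ even}.\end{cases}$$ Independently for each $i$: draw $Y^i\sim\mathrm{Bernoulli}(\pi_\alpha)$, $\pi_\alpha=e^\alpha/(e^\alpha+1)$, independent of $X^i$. If $Y^i=1$, draw $\tilde Z^i$ uniformly on $\{\tilde z\in\{-B,B\}^d:\langle\tilde z,\tilde X^i\rangle>0\text{ or }(\langle\tilde z,\tilde X^i\rangle=0\text{ and }\tilde z_1=B\tilde X^i_1)\}$; if $Y^i=0$, draw $\tilde Z^i$ uniformly on $\{\tilde z\in\{-B,B\}^d:\langle\tilde z,\tilde X^i\rangle<0\text{ or }(\langle\tilde z,\tilde X^i\rangle=0\text{ and }\tilde z_1=-B\tilde X^i_1)\}$. If $d$ is odd, $Z^i=\tilde Z^i$; if $d$ is even, $Z^i_1=\frac{d-2}{2(d-1)}\tilde Z^i_1$ and $Z^i_j=\tilde Z^i_j$ for $2\le j\le d$.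
   Formalization: The formal theorem additionally assumes τ ≥ 0; without it the claim fails, e.g. for d = s = 1, θ = 0, τ = −B, where the left side is 1 and the right side is exp(−n/2). *)

theory Defs
  imports "HOL-Probability.Probability"
begin

text \<open>Vectors of dimension \<open>d\<close> are functions on \<open>{1..d}\<close> in the sense of \<^const>\<open>PiM\<close>/\<^const>\<open>PiE\<close>:
  elements of \<open>{1..d} \<rightarrow>\<^sub>E UNIV\<close>, with value \<^const>\<open>undefined\<close> off \<open>{1..d}\<close>. The dimension enters
  the formulas below (parity, \<open>K\<^sub>d\<close>) and the coordinate 1 plays a special role, hence no type-indexed
  vectors.\<close>

abbreviation Rvec :: "nat \<Rightarrow> (nat \<Rightarrow> real) measure" where
  "Rvec d \<equiv> PiM {1..d} (\<lambda>_. borel)"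


subsection \<open>The data\<close>

definition strongly_log_concave :: "real \<Rightarrow> (real \<Rightarrow> real) \<Rightarrow> bool" where
  "strongly_log_concave c p \<longleftrightarrow>
     c > 0 \<and> (\<exists>\<phi>\<^sub>0. convex_on UNIV \<phi>\<^sub>0 \<and> (\<forall>x. \<phi>\<^sub>0 (- x) = \<phi>\<^sub>0 x) \<and>
       (\<forall>x. p x = exp (- \<phi>\<^sub>0 x) * exp (- c * x\<^sup>2 / 2)))"

definition noise_density :: "real \<Rightarrow> (real \<Rightarrow> real) \<Rightarrow> bool" where
  "noise_density c p \<longleftrightarrow>
     (let \<mu> = density lborel (\<lambda>x. ennreal (p x)) in
       prob_space \<mu> \<and>
       distr \<mu> borel (\<lambda>x. - x) = \<mu> \<and>
       prob_space.variance \<mu> (\<lambda>x. x) = 1 \<and>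
       strongly_log_concave c p)"

definition iid_noise ::
  "'w measure \<Rightarrow> nat \<Rightarrow> nat \<Rightarrow> (real \<Rightarrow> real) \<Rightarrow> (nat \<Rightarrow> nat \<Rightarrow> 'w \<Rightarrow> real) \<Rightarrow> bool" where
  "iid_noise M n d p \<xi> \<longleftrightarrow>
     prob_space.indep_vars M (\<lambda>_. borel) (\<lambda>(i, j). \<xi> i j) ({1..n} \<times> {1..d}) \<and>
     (\<forall>i\<in>{1..n}. \<forall>j\<in>{1..d}. distributed M lborel (\<xi> i j) (\<lambda>x. ennreal (p x)))"

definition observation ::
  "nat \<Rightarrow> (nat \<Rightarrow> real) \<Rightarrow> real \<Rightarrow> (nat \<Rightarrow> nat \<Rightarrow> 'w \<Rightarrow> real) \<Rightarrow> nat \<Rightarrow> 'w \<Rightarrow> nat \<Rightarrow> real" where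
  "observation d \<theta> \<sigma> \<xi> i \<omega> = (\<lambda>j\<in>{1..d}. \<theta> j + \<sigma> * \<xi> i j \<omega>)"


subsection \<open>Sparse parameters, Hamming loss\<close>

definition Theta_plus :: "nat \<Rightarrow> nat \<Rightarrow> real \<Rightarrow> (nat \<Rightarrow> real) set" where
  "Theta_plus d s a =
     {\<theta> \<in> {1..d} \<rightarrow>\<^sub>E UNIV. \<exists>S\<subseteq>{1..d}. card S \<le> s \<and>
        (\<forall>j\<in>S. \<theta> j \<ge> a) \<and> (\<forall>j\<in>{1..d} - S. \<theta> j = 0)}"

definition support :: "nat \<Rightarrow> (nat \<Rightarrow> real) \<Rightarrow> nat set" where
  "support d \<theta> = {j\<in>{1..d}. \<theta> j \<noteq> 0}"

definition support_indicator :: "(nat \<Rightarrow> real) \<Rightarrow> nat \<Rightarrow> nat" where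
  "support_indicator \<theta> j = of_bool (\<theta> j \<noteq> 0)"

definition hamming_loss :: "nat \<Rightarrow> (nat \<Rightarrow> nat) \<Rightarrow> (nat \<Rightarrow> nat) \<Rightarrow> real" where
  "hamming_loss d \<eta>' \<eta> = (\<Sum>j=1..d. of_bool (\<eta>' j \<noteq> \<eta> j))"


subsection \<open>The coordinate global privacy mechanism\<close>

text \<open>Unlike \<^const>\<open>sgn\<close>, this takes the value 1 at 0.\<close>

definition sign_pm :: "real \<Rightarrow> real" where
  "sign_pm x = (if x \<ge> 0 then 1 else - 1)"

text \<open>For \<open>d = 2\<close> the closed form of \<open>1/K\<^sub>d\<close> vanishes, so that \<open>K\<^sub>d\<close> is not a real number; with the
  convention \<open>1 / 0 = 0\<close> one gets \<open>cg_K 2 = 0\<close> and \<open>cg_B \<alpha> 2 = 0\<close>.\<close>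

definition cg_K :: "nat \<Rightarrow> real" where
  "cg_K d = 1 /
     (if odd d then 1 / 2 ^ (d - 1) * real ((d - 1) choose ((d - 1) div 2))
      else fact (d - 2) * (real d - 2) / (2 ^ (d - 1) * fact (d div 2 - 1) * fact (d div 2)))"

definition cg_B :: "real \<Rightarrow> nat \<Rightarrow> real" where
  "cg_B \<alpha> d = (exp \<alpha> + 1) / (exp \<alpha> - 1) * cg_K d"

definition cg_half_cube :: "nat \<Rightarrow> real \<Rightarrow> (nat \<Rightarrow> real) \<Rightarrow> bool \<Rightarrow> (nat \<Rightarrow> real) set" where
  "cg_half_cube d B x y =
     {z \<in> {1..d} \<rightarrow>\<^sub>E {- B, B}.
        let ip = (\<Sum>j=1..d. z j * x j) in
          if y then ip > 0 \<or> ip = 0 \<and> z 1 = B * x 1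
          else ip < 0 \<or> ip = 0 \<and> z 1 = - B * x 1}"

text \<open>\<open>X i\<close>, \<open>Y i\<close> and \<open>Zt i\<close> are the raw data, the coin and the vector drawn from the cube. The
  second conjunct says that \<open>Y i\<close> is Bernoulli and independent of \<open>X i\<close> (\<open>indep_var\<close> would need
  equal types), the last one that the conditional law of \<open>Zt i\<close> given \<open>(X i, Y i)\<close> is uniform on
  the half cube.\<close>

definition cg_mechanism ::
  "'w measure \<Rightarrow> nat \<Rightarrow> nat \<Rightarrow> real \<Rightarrow> (nat \<Rightarrow> 'w \<Rightarrow> nat \<Rightarrow> real) \<Rightarrow> (nat \<Rightarrow> 'w \<Rightarrow> bool) \<Rightarrow>
   (nat \<Rightarrow> 'w \<Rightarrow> nat \<Rightarrow> real) \<Rightarrow> bool" where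
  "cg_mechanism M n d \<alpha> X Y Zt \<longleftrightarrow>
     prob_space.indep_vars M (\<lambda>_. Rvec d \<Otimes>\<^sub>M (count_space UNIV \<Otimes>\<^sub>M Rvec d))
       (\<lambda>i \<omega>. (X i \<omega>, Y i \<omega>, Zt i \<omega>)) {1..n} \<and>
     (\<forall>i\<in>{1..n}.
        distr M (Rvec d \<Otimes>\<^sub>M count_space UNIV) (\<lambda>\<omega>. (X i \<omega>, Y i \<omega>))
          = distr M (Rvec d) (X i) \<Otimes>\<^sub>M measure_pmf (bernoulli_pmf (exp \<alpha> / (exp \<alpha> + 1))) \<and>
        (\<forall>C\<in>sets (Rvec d). AE \<omega> in M.
           real_cond_exp M
             (vimage_algebra (space M) (\<lambda>\<omega>. (X i \<omega>, Y i \<omega>)) (Rvec d \<Otimes>\<^sub>M count_space UNIV))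
             (indicator (Zt i -` C \<inter> space M)) \<omega>
           = measure_pmf.prob
               (pmf_of_set (cg_half_cube d (cg_B \<alpha> d) (\<lambda>j\<in>{1..d}. sign_pm (X i \<omega> j)) (Y i \<omega>))) C))"

definition cg_output :: "nat \<Rightarrow> (nat \<Rightarrow> real) \<Rightarrow> nat \<Rightarrow> real" where
  "cg_output d z =
     (if odd d then z else z(1 := (real d - 2) / (2 * (real d - 1)) * z 1))"

definition selector_plus :: "nat \<Rightarrow> real \<Rightarrow> (nat \<Rightarrow> nat \<Rightarrow> real) \<Rightarrow> nat \<Rightarrow> nat" where
  "selector_plus n \<tau> Z j = of_bool (1 / real n * (\<Sum>i=1..n. Z i j) \<ge> \<tau>)"

end

theory Submission
  imports Defs
begin

text \<open>The scaling \<open>B\<close> makes every privatized coordinate an unbiased estimate of the sign: identifying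
  vectors of the half cube with subsets of \<open>{1..d}\<close>, its mean is up to normalization a number of
  pivotal sets of the majority vote, a binomial coefficient that cancels \<open>K\<^sub>d\<close>. So \<open>Z\<^sup>i\<^sub>j\<close> takes values
  in \<open>[-B, B]\<close> and has mean \<open>E sgn (X\<^sup>i\<^sub>j)\<close>, which by symmetry of the noise is the noise mass of
  \<open>[-\<theta>\<^sub>j/\<sigma>, \<theta>\<^sub>j/\<sigma>]\<close>. This mass is 0 for \<open>\<theta>\<^sub>j = 0\<close>; for \<open>\<theta>\<^sub>j \<ge> a\<close> it is at least \<open>2 p(2) a/\<sigma>\<close>, since
  \<open>p\<close> is even and decreasing on the positive half-line and \<open>a/\<sigma> \<le> 2\<close>. Hoeffding's inequality then
  bounds the probability of a wrong decision in each coordinate. For \<open>d = 2\<close>, where \<open>B = 0\<close> because \<open>1 / 0 = 0\<close>,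
  both exponentials equal 1 and the bound is trivial.\<close>


subsection \<open>Majorities and pivotal sets\<close>

text \<open>A vertex of the half cube is encoded by the set \<open>T\<close> of coordinates at which
  its sign agrees with the sign vector, the latter negated if the coin is \<open>False\<close>. The
  tie rule at coordinate 1 mirrors the one in \<open>cg_half_cube\<close>.\<close>

definition majority :: "nat \<Rightarrow> nat set set" where
  "majority d = {T. T \<subseteq> {1..d} \<and> (d < 2 * card T \<or> d = 2 * card T \<and> 1 \<in> T)}"

definition pivotal :: "nat \<Rightarrow> nat \<Rightarrow> nat set set" where
  "pivotal d j = {T. T \<subseteq> {1..d} - {j} \<and> T \<notin> majority d \<and> insert j T \<in> majority d}"

lemma finite_majority [simp]: "finite (majority d)"
  by (rule finite_subset[of _ "Pow {1..d}"]) (auto simp: majority_def)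

lemma finite_pivotal [simp]: "finite (pivotal d j)"
  by (rule finite_subset[of _ "Pow {1..d}"]) (auto simp: pivotal_def)

text \<open>Complementation replaces \<open>card T\<close> by \<open>d - card T\<close> and, in a
  tie, moves coordinate 1 to the other side; hence exactly one of two complementary sets
  wins.\<close>

lemma compl_majority_iff:
  assumes "d \<ge> 1" "T \<subseteq> {1..d}"
  shows "{1..d} - T \<in> majority d \<longleftrightarrow> T \<notin> majority d"
proof -
  have "finite T"
    using assms(2) by (rule finite_subset) simp
  then have "card ({1..d} - T) = d - card T" "card T \<le> d"
    using assms(2) card_mono[of "{1..d}" T] by (auto simp: card_Diff_subset)
  then show ?thesis
    using assms by (auto simp: majority_def)
qed

text \<open>Complementation matches the majorities with the remaining subsets, so they make up half
  of the power set.\<close>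

lemma card_majority:
  assumes "d \<ge> 1"
  shows "card (majority d) = 2 ^ (d - 1)"
proof -
  have sub: "majority d \<subseteq> Pow {1..d}"
    by (auto simp: majority_def)
  have "bij_betw (\<lambda>T. {1..d} - T) (majority d) (Pow {1..d} - majority d)"
  proof (rule bij_betw_byWitness[where f' = "\<lambda>T. {1..d} - T"])
    show "(\<lambda>T. {1..d} - T) ` majority d \<subseteq> Pow {1..d} - majority d"
      using compl_majority_iff[OF assms] sub by blast
    show "(\<lambda>T. {1..d} - T) ` (Pow {1..d} - majority d) \<subseteq> majority d"
      using compl_majority_iff[OF assms] by blast
  qed (use sub in auto)
  then have "card (majority d) = card (Pow {1..d} - majority d)"
    by (rule bij_betw_same_card)
  also have "\<dots> = 2 ^ d - card (majority d)"
    using sub by (simp add: card_Diff_subset card_Pow)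
  finally have "2 * card (majority d) = 2 ^ d"
    using card_mono[OF _ sub] by (simp add: card_Pow)
  then show ?thesis
    using assms by (cases d) auto
qed

text \<open>Adding \<open>j\<close> keeps a set in the upward closed family \<^const>\<open>majority\<close>, so the members
  without \<open>j\<close> cancel against their extensions by \<open>j\<close>, and the pivotal sets are what remains.\<close>

lemma sum_majority:
  assumes "j \<in> {1..d}"
  shows "(\<Sum>T\<in>majority d. if j \<in> T then 1 else - 1) = real (card (pivotal d j))"
proof -
  define P1 where "P1 = {T \<in> majority d. j \<in> T}"
  define P0 where "P0 = {T \<in> majority d. j \<notin> T}"
  have fin: "finite P1" "finite P0"
    by (auto simp: P1_def P0_def)
  have up: "insert j T \<in> majority d" if "T \<in> P0" for T
  proof -
    have "finite T"
      using that by (auto simp: P0_def majority_def intro: finite_subset)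
    then show ?thesis
      using that assms by (auto simp: P0_def majority_def)
  qed
  \<comment> \<open>Removing \<open>j\<close> from a majority leaves either another majority or a
    set that only \<open>j\<close> turned into one.\<close>
  have "bij_betw (insert j) (P0 \<union> pivotal d j) P1"
  proof (rule bij_betw_byWitness[where f' = "\<lambda>T. T - {j}"])
    show "insert j ` (P0 \<union> pivotal d j) \<subseteq> P1"
      using up by (auto simp: P1_def pivotal_def)
    show "(\<lambda>T. T - {j}) ` P1 \<subseteq> P0 \<union> pivotal d j"
      by (auto simp: P1_def P0_def pivotal_def insert_absorb) (auto simp: majority_def)
  qed (auto simp: P0_def P1_def pivotal_def)
  then have "card P1 = card (P0 \<union> pivotal d j)"
    by (simp add: bij_betw_same_card)
  also have "\<dots> = card P0 + card (pivotal d j)"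
    using fin by (intro card_Un_disjoint) (auto simp: P0_def pivotal_def)
  finally have card: "card P1 = card P0 + card (pivotal d j)" .
  have "majority d = P1 \<union> P0" "P1 \<inter> P0 = {}"
    by (auto simp: P1_def P0_def)
  then have "(\<Sum>T\<in>majority d. if j \<in> T then 1 else - 1 :: real)
      = (\<Sum>T\<in>P1. if j \<in> T then 1 else - 1) + (\<Sum>T\<in>P0. if j \<in> T then 1 else - 1)"
    using fin by (simp add: sum.union_disjoint)
  also have "\<dots> = (\<Sum>T\<in>P1. 1) + (\<Sum>T\<in>P0. - 1)"
    by (intro arg_cong2[where f = "(+)"] sum.cong) (auto simp: P1_def P0_def)
  finally show ?thesis
    using card by simp
qed

text \<open>Pivotality depends only on the size of \<open>T\<close> and, in a tie, on coordinate 1;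
  the three counts below are read off from these inequalities.\<close>

lemma mem_pivotal_iff:
  assumes "j \<in> {1..d}" "T \<subseteq> {1..d} - {j}"
  shows "T \<in> pivotal d j \<longleftrightarrow>
    (2 * card T < d \<or> 2 * card T = d \<and> 1 \<notin> T) \<and>
    (d < 2 * card T + 2 \<or> d = 2 * card T + 2 \<and> (j = 1 \<or> 1 \<in> T))"
proof -
  have "finite T"
    using assms by (auto intro: finite_subset)
  moreover have "j \<notin> T"
    using assms by auto
  ultimately have "card (insert j T) = card T + 1"
    by simp
  then show ?thesis
    using assms unfolding pivotal_def majority_def by auto
qed

text \<open>For odd \<open>d\<close> there are no ties, so \<open>j\<close> decides exactly when the
  other \<open>d - 1\<close> coordinates split evenly.\<close>

lemma card_pivotal_odd:
  assumes "j \<in> {1..d}" "odd d"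
  shows "card (pivotal d j) = (d - 1) choose ((d - 1) div 2)"
proof -
  have "pivotal d j = {T. T \<subseteq> {1..d} - {j} \<and> card T = (d - 1) div 2}"
  proof (intro set_eqI iffI)
    fix T assume T: "T \<in> pivotal d j"
    then have sub: "T \<subseteq> {1..d} - {j}"
      by (simp add: pivotal_def)
    show "T \<in> {T. T \<subseteq> {1..d} - {j} \<and> card T = (d - 1) div 2}"
      using T sub assms(2) unfolding mem_pivotal_iff[OF assms(1) sub] by (auto elim!: oddE)
  next
    fix T assume "T \<in> {T. T \<subseteq> {1..d} - {j} \<and> card T = (d - 1) div 2}"
    then have sub: "T \<subseteq> {1..d} - {j}" and "card T = (d - 1) div 2"
      by auto
    then show "T \<in> pivotal d j"
      using assms(2) unfolding mem_pivotal_iff[OF assms(1) sub] by (auto elim!: oddE)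
  qed
  then show ?thesis
    using assms by (simp add: n_subsets)
qed

text \<open>Coordinate 1 decides in two situations: with \<open>k\<close> others it produces a tie,
  which it then wins, and with \<open>k + 1\<close> others it breaks an existing tie. Pascal's rule
  adds up the two counts.\<close>

lemma card_pivotal_even_first:
  assumes "d = 2 * k + 2"
  shows "card (pivotal d 1) = d choose (k + 1)"
proof -
  have one: "1 \<in> {1..d}"
    using assms by simp
  have "pivotal d 1 = {T. T \<subseteq> {1..d} - {1} \<and> card T = k} \<union>
      {T. T \<subseteq> {1..d} - {1} \<and> card T = k + 1}" (is "_ = ?L \<union> ?R")
  proof (intro set_eqI iffI)
    fix T assume T: "T \<in> pivotal d 1"
    then have sub: "T \<subseteq> {1..d} - {1}"
      by (simp add: pivotal_def)
    show "T \<in> ?L \<union> ?R"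
      using T sub assms unfolding mem_pivotal_iff[OF one sub] by auto
  next
    fix T assume T: "T \<in> ?L \<union> ?R"
    then have sub: "T \<subseteq> {1..d} - {1}"
      by auto
    then show "T \<in> pivotal d 1"
      using T assms unfolding mem_pivotal_iff[OF one sub] by auto
  qed
  moreover have "finite ?L" "finite ?R"
    by (auto intro: finite_subset[of _ "Pow {1..d}"])
  ultimately have "card (pivotal d 1) = card ?L + card ?R"
    by (simp only:) (rule card_Un_disjoint, auto)
  also have "\<dots> = ((2 * k + 1) choose k) + ((2 * k + 1) choose (k + 1))"
    using assms by (subst (1 2) n_subsets) auto
  also have "\<dots> = d choose (k + 1)"
    using assms by simp
  finally show ?thesis .
qed

text \<open>Another coordinate \<open>j\<close> decides either by producing a tie that coordinate 1,
  already in \<open>T\<close>, wins, or by breaking a tie that would be lost because 1 is not in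
  \<open>T\<close>. Then \<open>T\<close> has \<open>k\<close> or \<open>k + 2\<close> members among
  the \<open>d - 2\<close> coordinates other than 1 and \<open>j\<close>, and these two counts agree
  by symmetry of the binomial coefficients.\<close>

lemma card_pivotal_even_other:
  assumes "j \<in> {1..d}" "j \<noteq> 1" "d = 2 * k + 4"
  shows "card (pivotal d j) = 2 * ((d - 2) choose k)"
proof -
  let ?D = "{1..d} - {1, j}"
  let ?L = "{T. T \<subseteq> ?D \<and> card T = k}" and ?R = "{T. T \<subseteq> ?D \<and> card T = k + 2}"
  have card_D: "card ?D = d - 2"
    using assms by (subst card_Diff_subset) auto
  have fin: "finite T" if "T \<subseteq> {1..d} - {j}" for T
    using that by (auto intro: finite_subset)
  have eq: "pivotal d j = insert 1 ` ?L \<union> ?R"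
  proof (intro set_eqI iffI)
    fix T assume T: "T \<in> pivotal d j"
    then have sub: "T \<subseteq> {1..d} - {j}"
      by (simp add: pivotal_def)
    show "T \<in> insert 1 ` ?L \<union> ?R"
    proof (cases "1 \<in> T")
      case True
      then have "T = insert 1 (T - {1})" "card (T - {1}) = card T - 1"
        using fin[OF sub] by auto
      moreover have "card T = k + 1"
        using T assms True unfolding mem_pivotal_iff[OF assms(1) sub] by auto
      ultimately show ?thesis
        using sub by (intro UnI1 image_eqI[where x = "T - {1}"]) auto
    next
      case False
      then show ?thesis
        using T sub assms unfolding mem_pivotal_iff[OF assms(1) sub] by auto
    qed
  next
    fix T assume T: "T \<in> insert 1 ` ?L \<union> ?R"
    then have sub: "T \<subseteq> {1..d} - {j}"
      using assms by auto
    show "T \<in> pivotal d j"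
    proof (cases "T \<in> ?R")
      case True
      then show ?thesis
        using assms unfolding mem_pivotal_iff[OF assms(1) sub] by auto
    next
      case False
      then obtain U where U: "T = insert 1 U" "U \<subseteq> ?D" "card U = k"
        using T by auto
      then have "finite U" "1 \<notin> U"
        by (auto intro: finite_subset)
      then have "card T = k + 1"
        using U by simp
      then show ?thesis
        using assms U unfolding mem_pivotal_iff[OF assms(1) sub] by auto
    qed
  qed
  have finL: "finite ?L" "finite ?R"
    by (auto intro: finite_subset[of _ "Pow {1..d}"])
  have "card (pivotal d j) = card (insert 1 ` ?L) + card ?R"
    unfolding eq using finL by (intro card_Un_disjoint) auto
  also have "card (insert 1 ` ?L) = card ?L"
  proof (rule card_image, rule inj_onI)
    fix U V assume "U \<in> ?L" "V \<in> ?L" and eq: "insert 1 U = insert 1 V"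
    then have "1 \<notin> U" "1 \<notin> V"
      by auto
    then show "U = V"
      using eq by (simp add: insert_ident)
  qed
  also have "card ?L = (d - 2) choose k"
    by (subst n_subsets) (use card_D in simp_all)
  also have "card ?R = (d - 2) choose (k + 2)"
    by (subst n_subsets) (use card_D in simp_all)
  also have "(d - 2) choose (k + 2) = (d - 2) choose k"
    using binomial_symmetric[of k "d - 2"] assms by simp
  finally show ?thesis
    by simp
qed

section \<open>The normalizing constant against the number of pivotal sets\<close>

definition cg_scale :: "nat \<Rightarrow> nat \<Rightarrow> real" where
  "cg_scale d j = (if even d \<and> j = 1 then (real d - 2) / (2 * (real d - 1)) else 1)"

lemma cg_output_eq: "cg_output d z j = cg_scale d j * z j"
  by (simp add: cg_output_def cg_scale_def)

text \<open>An even \<open>d\<close> other than 2 is at least 4; at \<open>d = 2\<close> the factor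
  of coordinate 1 would vanish.\<close>

lemma cg_scale_bounds:
  assumes "d \<ge> 1" "d \<noteq> 2"
  shows "0 < cg_scale d j" "cg_scale d j \<le> 1"
proof -
  have "even d \<Longrightarrow> real d \<ge> 4"
    using assms by (auto elim!: evenE)
  then show "0 < cg_scale d j" "cg_scale d j \<le> 1"
    by (auto simp: cg_scale_def field_simps)
qed

lemma cg_K_pos:
  assumes "d \<ge> 1" "d \<noteq> 2"
  shows "cg_K d > 0"
proof -
  have "even d \<Longrightarrow> real d \<ge> 4"
    using assms by (auto elim!: evenE)
  moreover have "0 < (d - 1) choose ((d - 1) div 2)"
    by (rule zero_less_binomial) simp
  ultimately show ?thesis
    by (auto simp: cg_K_def)
qed

text \<open>This is why \<open>cg_K\<close> and the factor in \<open>cg_output\<close> have their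
  form: after scaling, all coordinates have the same bias. For even \<open>d\<close> coordinate 1 is
  pivotal \<open>2 * (d - 1) / (d - 2)\<close> times as often as any other, and
  \<open>cg_scale\<close> is the reciprocal of this ratio.\<close>

lemma cg_K_pivotal:
  assumes "j \<in> {1..d}" "d \<noteq> 2"
  shows "cg_K d * cg_scale d j * real (card (pivotal d j)) = 2 ^ (d - 1)"
proof (cases "odd d")
  case True
  have "0 < (d - 1) choose ((d - 1) div 2)"
    by (rule zero_less_binomial) simp
  then show ?thesis
    using True assms by (simp add: cg_K_def cg_scale_def card_pivotal_odd)
next
  case False
  then obtain l where "d = 2 * l"
    by auto
  \<comment> \<open>Here \<open>l\<close> is at least 2 because \<open>d\<close> is positive and not
    2, so the truncated subtraction is exact.\<close>
  moreover define k where "k = l - 2"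
  ultimately have d: "d = 2 * k + 4"
    using assms by (cases l; cases "l - 1") auto
  \<comment> \<open>In terms of \<open>d\<close>: \<open>u\<close> is \<open>d - 2\<close>,
    \<open>v\<close> is \<open>d - 1\<close>, and \<open>A\<close>, \<open>C\<close>,
    \<open>F\<close> are the factorials of \<open>d / 2 - 1\<close>, \<open>d / 2\<close> and
    \<open>d - 2\<close>, the ingredients of \<open>cg_K\<close>.\<close>
  define u v :: real where "u = 2 * k + 2" and "v = 2 * k + 3"
  define A C F :: real where "A = fact (k + 1)" and "C = fact (k + 2)" and "F = fact (2 * k + 2)"
  have pos: "A > 0" "C > 0" "F > 0" "u > 0" "v > 0"
    by (auto simp: A_def C_def F_def u_def v_def simp del: fact_Suc)
  have K: "cg_K d = 2 ^ (d - 1) * A * C / (F * u)"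
  proof -
    have "d - 2 = 2 * k + 2" "d div 2 - 1 = k + 1" "d div 2 = k + 2" "real d - 2 = u"
      using d by (auto simp: u_def)
    then show ?thesis
      using False by (simp add: cg_K_def A_def C_def F_def mult_ac)
  qed
  show ?thesis
  proof (cases "j = 1")
    case True
    have "card (pivotal d j) = d choose (k + 2)"
      using card_pivotal_even_first[of d "k + 1"] True d by simp
    also have "real \<dots> = fact (2 * k + 4) / (C * C)"
    proof -
      have "k + 2 \<le> d" "d - (k + 2) = k + 2"
        using d by auto
      then show ?thesis
        using binomial_fact[of "k + 2" d, where 'a = real] unfolding C_def by (simp only: d)
    qed
    \<comment> \<open>The factor \<open>u + 2\<close>, which is \<open>d\<close>, cancels against
      the \<open>d / 2\<close> split off from one \<open>C\<close> in the denominator. What remains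
      beyond \<open>cg_K\<close> is \<open>2 * v / u\<close>, which \<open>cg_scale\<close>
      removes.\<close>
    also have "fact (2 * k + 4) = (u + 2) * (v * F)"
      using fact_Suc[of "2 * k + 3", where 'a = real] fact_Suc[of "2 * k + 2", where 'a = real]
      by (simp add: F_def u_def v_def eval_nat_numeral del: fact_Suc)
    also have "C * C = ((u + 2) / 2 * A) * C"
      using fact_Suc[of "k + 1", where 'a = real]
      by (simp add: C_def A_def u_def eval_nat_numeral del: fact_Suc)
    finally have c: "real (card (pivotal d j)) = (u + 2) * (v * F) / (((u + 2) / 2 * A) * C)" .
    have s: "cg_scale d j = u / (2 * v)"
      using True d by (simp add: cg_scale_def u_def v_def)
    show ?thesis
      unfolding K s c using pos by (simp add: add_eq_0_iff)
  next
    case other: False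
    have "card (pivotal d j) = 2 * ((d - 2) choose k)"
      using card_pivotal_even_other[of j d k] other d assms by simp
    also have "real \<dots> = 2 * (F / (fact k * C))"
    proof -
      have "k \<le> d - 2" "d - 2 - k = k + 2" "d - 2 = 2 * k + 2"
        using d by auto
      then show ?thesis
        using binomial_fact[of k "d - 2", where 'a = real] unfolding C_def F_def
        by (simp del: fact_Suc)
    qed
    also have "\<dots> = u * F / (A * C)"
    proof -
      have *: "A = u / 2 * fact k"
        by (simp add: A_def u_def algebra_simps)
      show ?thesis
        unfolding * using pos by (simp add: field_simps)
    qed
    finally have c: "real (card (pivotal d j)) = u * F / (A * C)" .
    have s: "cg_scale d j = 1"
      using other by (simp add: cg_scale_def)
    show ?thesis
      unfolding K s c using pos by simp
  qed
qed


subsection \<open>The uniform law on the half cube\<close>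

text \<open>The vertex belonging to \<open>T\<close> has inner product with \<open>x\<close> equal
  to \<open>2 * card T - d\<close> up to the factor \<open>B\<close> and the sign of the coin. The
  condition on the inner product thus becomes a condition on the size of \<open>T\<close>, and the
  tie rule becomes membership of 1.\<close>

lemma bij_betw_majority_half_cube:
  fixes B :: real and x :: "nat \<Rightarrow> real"
  assumes "d \<ge> 1" "B > 0" and x: "\<And>k. k \<in> {1..d} \<Longrightarrow> x k \<in> {- 1, 1}"
  shows "bij_betw
    (\<lambda>T. \<lambda>k\<in>{1..d}. B * ((if y then 1 else - 1) * x k * (if k \<in> T then 1 else - 1)))
    (majority d) (cg_half_cube d B x y)"
proof -
  define e :: real where "e = (if y then 1 else - 1)"
  define \<phi> where "\<phi> = (\<lambda>T. \<lambda>k\<in>{1..d}. B * (e * x k * (if k \<in> T then 1 else - 1)))"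
  have ip: "(\<Sum>k=1..d. \<phi> T k * x k) = B * (e * (2 * real (card T) - real d))"
    if "T \<subseteq> {1..d}" for T
  proof -
    have "(\<Sum>k=1..d. \<phi> T k * x k) = (\<Sum>k=1..d. B * (e * (if k \<in> T then 1 else - 1)))"
    proof (intro sum.cong refl)
      fix k assume k: "k \<in> {1..d}"
      then have "x k * x k = 1"
        using x[OF k] by auto
      then show "\<phi> T k * x k = B * (e * (if k \<in> T then 1 else - 1))"
        using k by (simp add: \<phi>_def)
    qed
    also have "\<dots> = B * (e * (\<Sum>k=1..d. if k \<in> T then 1 else - 1))"
      by (simp add: sum_distrib_left)
    also have "(\<Sum>k=1..d. if k \<in> T then 1 else - 1) = (\<Sum>k=1..d. 2 * of_bool (k \<in> T) - (1::real))"
      by (intro sum.cong) auto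
    also have "\<dots> = 2 * real (card T) - real d"
      using that by (simp add: sum_subtractf sum_distrib_left [symmetric] Int_absorb1)
    finally show ?thesis .
  qed
  have mem: "\<phi> T \<in> cg_half_cube d B x y \<longleftrightarrow> T \<in> majority d" if T: "T \<subseteq> {1..d}" for T
  proof -
    have "\<phi> T \<in> {1..d} \<rightarrow>\<^sub>E {- B, B}"
      using x by (fastforce simp: \<phi>_def e_def)
    moreover have "\<phi> T 1 = B * (e * x 1 * (if 1 \<in> T then 1 else - 1))" "x 1 \<in> {- 1, 1}"
      using assms by (auto simp: \<phi>_def)
    moreover have "B * r > 0 \<longleftrightarrow> r > 0" "B * r < 0 \<longleftrightarrow> r < 0" "B * r = 0 \<longleftrightarrow> r = 0" for r
      using assms(2) by (auto simp: zero_less_mult_iff mult_less_0_iff)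
    ultimately show ?thesis
      using T assms(2) unfolding cg_half_cube_def majority_def mem_Collect_eq Let_def ip[OF T]
      by (auto simp: e_def)
  qed
  have "bij_betw \<phi> (Pow {1..d}) ({1..d} \<rightarrow>\<^sub>E {- B, B})"
  proof (rule bij_betw_byWitness[where f' = "\<lambda>z. {k \<in> {1..d}. z k = B * (e * x k)}"])
    show "\<forall>T\<in>Pow {1..d}. {k \<in> {1..d}. \<phi> T k = B * (e * x k)} = T"
    proof
      fix T assume "T \<in> Pow {1..d}"
      moreover have "\<phi> T k = B * (e * x k) \<longleftrightarrow> k \<in> T" if "k \<in> {1..d}" for k
        using x[OF that] that assms(2) by (auto simp: \<phi>_def e_def)
      ultimately show "{k \<in> {1..d}. \<phi> T k = B * (e * x k)} = T"
        by blast
    qed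
    show "\<forall>z\<in>{1..d} \<rightarrow>\<^sub>E {- B, B}. \<phi> {k \<in> {1..d}. z k = B * (e * x k)} = z"
    proof
      fix z assume z: "z \<in> {1..d} \<rightarrow>\<^sub>E {- B, B}"
      show "\<phi> {k \<in> {1..d}. z k = B * (e * x k)} = z"
      proof
        fix k
        show "\<phi> {k \<in> {1..d}. z k = B * (e * x k)} k = z k"
        proof (cases "k \<in> {1..d}")
          case True
          then have "z k \<in> {- B, B}"
            using z by blast
          then show ?thesis
            using x[OF True] True by (auto simp: \<phi>_def e_def)
        next
          case False
          then show ?thesis
            unfolding PiE_arb[OF z False] by (simp only: \<phi>_def restrict_apply False if_False)
        qed
      qed
    qed
    show "\<phi> ` Pow {1..d} \<subseteq> {1..d} \<rightarrow>\<^sub>E {- B, B}"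
      using x by (fastforce simp: \<phi>_def e_def)
  qed auto
  then have bij: "inj_on \<phi> (Pow {1..d})" "\<phi> ` Pow {1..d} = {1..d} \<rightarrow>\<^sub>E {- B, B}"
    by (auto simp: bij_betw_def)
  have sub: "majority d \<subseteq> Pow {1..d}"
    by (auto simp: majority_def)
  have "\<phi> ` majority d = cg_half_cube d B x y"
  proof (intro equalityI subsetI)
    fix z assume "z \<in> \<phi> ` majority d"
    then show "z \<in> cg_half_cube d B x y"
      using mem sub by auto
  next
    fix z assume z: "z \<in> cg_half_cube d B x y"
    then have "z \<in> \<phi> ` Pow {1..d}"
      unfolding bij(2) by (simp add: cg_half_cube_def)
    then show "z \<in> \<phi> ` majority d"
      using mem z by auto
  qed
  moreover have "inj_on \<phi> (majority d)"
    using bij(1) sub by (rule inj_on_subset)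
  ultimately show ?thesis
    by (simp add: bij_betw_def \<phi>_def e_def)
qed

text \<open>Both counts are carried over along the bijection; coordinate \<open>j\<close> of a
  vertex changes sign with membership of \<open>j\<close> in \<open>T\<close>, so
  \<open>sum_majority\<close> brings in the pivotal sets.\<close>

lemma
  fixes B :: real and x :: "nat \<Rightarrow> real"
  assumes "d \<ge> 1" "B > 0" and x: "\<And>k. k \<in> {1..d} \<Longrightarrow> x k \<in> {- 1, 1}"
  shows card_half_cube: "card (cg_half_cube d B x y) = 2 ^ (d - 1)"
    and sum_half_cube: "j \<in> {1..d} \<Longrightarrow> (\<Sum>z\<in>cg_half_cube d B x y. z j) =
      B * ((if y then 1 else - 1) * x j * real (card (pivotal d j)))"
proof -
  note bij = bij_betw_majority_half_cube[where x = x and y = y, OF assms]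
  show "card (cg_half_cube d B x y) = 2 ^ (d - 1)"
    using bij_betw_same_card[OF bij] card_majority[OF assms(1)] by simp
  assume j: "j \<in> {1..d}"
  have "(\<Sum>z\<in>cg_half_cube d B x y. z j) = (\<Sum>T\<in>majority d.
      B * ((if y then 1 else - 1) * x j * (if j \<in> T then 1 else - 1)))"
    using sum.reindex_bij_betw[OF bij, where g = "\<lambda>z. z j"] j by simp
  also have "\<dots> = B * ((if y then 1 else - 1) * x j * (\<Sum>T\<in>majority d. if j \<in> T then 1 else - 1))"
    by (simp only: sum_distrib_left)
  finally show "(\<Sum>z\<in>cg_half_cube d B x y. z j) =
      B * ((if y then 1 else - 1) * x j * real (card (pivotal d j)))"
    unfolding sum_majority[OF j] .
qed

lemma finite_half_cube: "finite (cg_half_cube d B x y)"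
  by (rule finite_subset[of _ "{1..d} \<rightarrow>\<^sub>E {- B, B}"]) (auto simp: cg_half_cube_def finite_PiE)

lemma cg_B_pos:
  assumes "d \<ge> 1" "d \<noteq> 2" "\<alpha> > 0"
  shows "cg_B \<alpha> d > 0"
  unfolding cg_B_def using cg_K_pos[OF assms(1,2)] assms(3)
  by (intro mult_pos_pos divide_pos_pos) (simp_all add: add_pos_pos)

text \<open>The factor \<open>cg_scale\<close> compensates the tie-breaking rule, which favours the coordinate 1.\<close>

lemma half_cube_bias:
  fixes \<alpha> :: real and d j :: nat and y :: bool and x :: "nat \<Rightarrow> real"
  defines "B \<equiv> cg_B \<alpha> d"
  assumes "j \<in> {1..d}" "d \<noteq> 2" "\<alpha> > 0"
    and x: "\<And>k. k \<in> {1..d} \<Longrightarrow> x k \<in> {- 1, 1}"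
  defines "P \<equiv> measure_pmf.prob (pmf_of_set (cg_half_cube d B x y))"
  shows "P {z \<in> space (Rvec d). z j \<in> {- B, B}} = 1"
    and "cg_scale d j * B *
        (P {z \<in> space (Rvec d). z j = B} - P {z \<in> space (Rvec d). z j = - B}) =
      (exp \<alpha> + 1) / (exp \<alpha> - 1) * (if y then 1 else - 1) * x j"
proof -
  let ?A = "cg_half_cube d B x y"
  have d: "d \<ge> 1"
    using assms by auto
  then have B: "B > 0"
    using cg_B_pos assms by simp
  have card: "card ?A = 2 ^ (d - 1)"
    by (rule card_half_cube[OF d B x])
  have ne: "?A \<noteq> {}" "finite ?A"
    using card by (auto intro: finite_half_cube)
  have P: "P C = card (?A \<inter> C) / 2 ^ (d - 1)" for C
    unfolding P_def using measure_pmf_of_set[OF ne] card by simp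
  have sub: "?A \<subseteq> {1..d} \<rightarrow>\<^sub>E {- B, B}"
    by (auto simp: cg_half_cube_def)
  then have "?A \<inter> {z \<in> space (Rvec d). z j \<in> {- B, B}} = ?A"
    using assms(2) by (fastforce simp: space_PiM PiE_iff)
  then show "P {z \<in> space (Rvec d). z j \<in> {- B, B}} = 1"
    by (simp add: P card)
  define Ap where "Ap = ?A \<inter> {z \<in> space (Rvec d). z j = B}"
  define Am where "Am = ?A \<inter> {z \<in> space (Rvec d). z j = - B}"
  have "?A = Ap \<union> Am" "Ap \<inter> Am = {}"
    using sub assms(2) B by (fastforce simp: Ap_def Am_def space_PiM PiE_iff)+
  moreover have "finite Ap" "finite Am"
    using ne by (auto simp: Ap_def Am_def)
  ultimately have "(\<Sum>z\<in>?A. z j) = (\<Sum>z\<in>Ap. z j) + (\<Sum>z\<in>Am. z j)"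
    by (simp add: sum.union_disjoint)
  also have "\<dots> = (\<Sum>z\<in>Ap. B) + (\<Sum>z\<in>Am. - B)"
    by (intro arg_cong2[where f = "(+)"] sum.cong) (auto simp: Ap_def Am_def)
  also have "\<dots> = B * (real (card Ap) - real (card Am))"
    by (simp add: algebra_simps)
  finally have "real (card Ap) - real (card Am) =
      (if y then 1 else - 1) * x j * real (card (pivotal d j))"
    using sum_half_cube[where x = x and y = y, OF d B x assms(2)] B by (simp add: mult_ac)
  then have diff: "P {z \<in> space (Rvec d). z j = B} - P {z \<in> space (Rvec d). z j = - B} =
      (if y then 1 else - 1) * x j * real (card (pivotal d j)) / 2 ^ (d - 1)"
    unfolding P Ap_def[symmetric] Am_def[symmetric] diff_divide_distrib[symmetric] by simp
  \<comment> \<open>Splitting \<open>B\<close> into the privacy factor and \<open>cg_K\<close>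
    isolates a last fraction that \<open>cg_K_pivotal\<close> evaluates to 1.\<close>
  have "cg_scale d j * B * (P {z \<in> space (Rvec d). z j = B} - P {z \<in> space (Rvec d). z j = - B})
      = (exp \<alpha> + 1) / (exp \<alpha> - 1) * (if y then 1 else - 1) * x j *
        (cg_K d * cg_scale d j * real (card (pivotal d j)) / 2 ^ (d - 1))"
    unfolding diff unfolding B_def cg_B_def by (simp only: times_divide_eq_left times_divide_eq_right mult_ac)
  then show "cg_scale d j * B * (P {z \<in> space (Rvec d). z j = B} - P {z \<in> space (Rvec d). z j = - B})
      = (exp \<alpha> + 1) / (exp \<alpha> - 1) * (if y then 1 else - 1) * x j"
    unfolding cg_K_pivotal[OF assms(2,3)] by simp
qed


subsection \<open>Bias and range of a privatized coordinate\<close>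

lemma sign_pm_measurable [measurable]: "sign_pm \<in> borel_measurable borel"
  unfolding sign_pm_def[abs_def] by measurable

lemma sign_pm_cases: "sign_pm x \<in> {- 1, 1}"
  by (simp add: sign_pm_def)

text \<open>The law of \<open>Zt\<close> given \<open>(X, Y)\<close> is available only through
  conditional probabilities of events, so range and mean are both derived from events fixing
  coordinate \<open>j\<close> to \<open>B\<close> or \<open>- B\<close>. Averaging over the coin
  then removes the privacy factor.\<close>

lemma (in prob_space) cg_mechanism_coordinate:
  fixes \<alpha> :: real and d j :: nat
    and X Zt :: "'a \<Rightarrow> nat \<Rightarrow> real" and Y :: "'a \<Rightarrow> bool"
  defines "B \<equiv> cg_B \<alpha> d"
  assumes [measurable]: "X \<in> M \<rightarrow>\<^sub>M Rvec d" "Y \<in> M \<rightarrow>\<^sub>M count_space UNIV" "Zt \<in> M \<rightarrow>\<^sub>M Rvec d"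
    and indep: "distr M (Rvec d \<Otimes>\<^sub>M count_space UNIV) (\<lambda>\<omega>. (X \<omega>, Y \<omega>))
      = distr M (Rvec d) X \<Otimes>\<^sub>M measure_pmf (bernoulli_pmf (exp \<alpha> / (exp \<alpha> + 1)))"
    and cond: "\<And>C. C \<in> sets (Rvec d) \<Longrightarrow> AE \<omega> in M.
      real_cond_exp M (vimage_algebra (space M) (\<lambda>\<omega>. (X \<omega>, Y \<omega>)) (Rvec d \<Otimes>\<^sub>M count_space UNIV))
        (indicator (Zt -` C \<inter> space M)) \<omega>
      = measure_pmf.prob (pmf_of_set (cg_half_cube d B (\<lambda>j\<in>{1..d}. sign_pm (X \<omega> j)) (Y \<omega>))) C"
    and j: "j \<in> {1..d}" and d: "d \<noteq> 2" and \<alpha>: "\<alpha> > 0"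
  shows "AE \<omega> in M. Zt \<omega> j \<in> {- B, B}"
    and "expectation (\<lambda>\<omega>. cg_scale d j * Zt \<omega> j) = expectation (\<lambda>\<omega>. sign_pm (X \<omega> j))"
proof -
  define F where
    "F = vimage_algebra (space M) (\<lambda>\<omega>. (X \<omega>, Y \<omega>)) (Rvec d \<Otimes>\<^sub>M count_space UNIV)"
  define ev where "ev C = Zt -` C \<inter> space M" for C
  define \<kappa> where "\<kappa> = (exp \<alpha> + 1) / (exp \<alpha> - 1)"
  define xi where "xi \<omega> = (\<lambda>j\<in>{1..d}. sign_pm (X \<omega> j))" for \<omega>
  have xi: "xi \<omega> k \<in> {- 1, 1}" if "k \<in> {1..d}" for \<omega> k
    using that sign_pm_cases[of "X \<omega> k"] by (simp add: xi_def)
  have B: "B > 0"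
    using cg_B_pos[of d \<alpha>] j d \<alpha> by (simp add: B_def)
  have Zj [measurable]: "(\<lambda>\<omega>. Zt \<omega> j) \<in> borel_measurable M"
    by (rule measurable_compose[OF _ measurable_component_singleton[OF j]]) measurable
  have Xj [measurable]: "(\<lambda>\<omega>. X \<omega> j) \<in> borel_measurable M"
    by (rule measurable_compose[OF _ measurable_component_singleton[OF j]]) measurable
  have proj [measurable]: "(\<lambda>z. z j) \<in> borel_measurable (Rvec d)"
    by (rule measurable_component_singleton[OF j])

  have [measurable]: "(\<lambda>\<omega>. (X \<omega>, Y \<omega>)) \<in> M \<rightarrow>\<^sub>M Rvec d \<Otimes>\<^sub>M count_space UNIV"
    by measurable
  then have sub: "subalgebra M F"
    unfolding subalgebra_def F_def
    by (auto simp: sets_vimage_algebra intro!: sets.sigma_sets_subset measurable_sets)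
  interpret F: finite_measure_subalgebra M F
    by unfold_locales (rule sub)
  have ev [measurable]: "ev C \<in> events" if "C \<in> sets (Rvec d)" for C
    unfolding ev_def using that by measurable
  have int_ind: "integrable M (indicator (ev C) :: 'a \<Rightarrow> real)" if "C \<in> sets (Rvec d)" for C
    using ev[OF that] by (simp add: emeasure_eq_measure)
  \<comment> \<open>The tower property: conditional probabilities average to unconditional
    ones.\<close>
  have ce: "expectation (real_cond_exp M F (indicator (ev C))) = prob (ev C)"
    "integrable M (real_cond_exp M F (indicator (ev C)))" if "C \<in> sets (Rvec d)" for C
    using F.real_cond_exp_int[OF int_ind[OF that]] ev[OF that] by auto
  have AE_ce: "AE \<omega> in M. real_cond_exp M F (indicator (ev C)) \<omega> =
      measure_pmf.prob (pmf_of_set (cg_half_cube d B (xi \<omega>) (Y \<omega>))) C" if "C \<in> sets (Rvec d)" for C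
    using cond[OF that] unfolding F_def ev_def xi_def .

  define C0 where "C0 = {z \<in> space (Rvec d). z j \<in> {- B, B}}"
  define Cp where "Cp = {z \<in> space (Rvec d). z j = B}"
  define Cm where "Cm = {z \<in> space (Rvec d). z j = - B}"
  have C: "C0 \<in> sets (Rvec d)" "Cp \<in> sets (Rvec d)" "Cm \<in> sets (Rvec d)"
    unfolding C0_def Cp_def Cm_def by measurable

  have "AE \<omega> in M. real_cond_exp M F (indicator (ev C0)) \<omega> = 1"
    using AE_ce[OF C(1)] half_cube_bias(1)[where x = "xi _", OF j d \<alpha> xi] unfolding C0_def B_def by auto
  then have "expectation (real_cond_exp M F (indicator (ev C0))) = expectation (\<lambda>_. 1)"
    by (intro integral_cong_AE) auto
  then have "prob (ev C0) = 1"
    using ce(1)[OF C(1)] by (simp add: prob_space)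
  then have "AE \<omega> in M. \<omega> \<in> ev C0"
    using AE_prob_1 by blast
  then show AE_Z: "AE \<omega> in M. Zt \<omega> j \<in> {- B, B}"
    by eventually_elim (auto simp: ev_def C0_def)

  \<comment> \<open>This is the conditional mean of the scaled coordinate given data and coin, as
    computed in \<open>half_cube_bias\<close>.\<close>
  let ?G = "\<lambda>(x, y). \<kappa> * (if y then 1 else - 1) * sign_pm (x j) :: real"
  have G [measurable]: "?G \<in> borel_measurable (Rvec d \<Otimes>\<^sub>M count_space UNIV)"
    by measurable
  \<comment> \<open>Almost surely the coordinate takes only the values \<open>B\<close> and
    \<open>- B\<close>, so its mean is determined by two probabilities.\<close>
  have "expectation (\<lambda>\<omega>. Zt \<omega> j) = expectation (\<lambda>\<omega>. B * indicator (ev Cp) \<omega> - B * indicator (ev Cm) \<omega>)"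
  proof (intro integral_cong_AE)
    show "AE \<omega> in M. Zt \<omega> j = B * indicator (ev Cp) \<omega> - B * indicator (ev Cm) \<omega>"
      using AE_Z AE_space
    proof eventually_elim
      case (elim \<omega>)
      then have "Zt \<omega> \<in> space (Rvec d)"
        using measurable_space[OF assms(4)] by simp
      then have "\<omega> \<in> ev Cp \<longleftrightarrow> Zt \<omega> j = B" "\<omega> \<in> ev Cm \<longleftrightarrow> Zt \<omega> j = - B"
        using elim by (auto simp: ev_def Cp_def Cm_def)
      then show ?case
        using elim B by (auto simp: indicator_def)
    qed
  qed (use C in measurable)
  also have "\<dots> = B * (prob (ev Cp) - prob (ev Cm))"
    using int_ind[OF C(2)] int_ind[OF C(3)] ev[OF C(2)] ev[OF C(3)] by (simp add: algebra_simps)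
  finally have "expectation (\<lambda>\<omega>. cg_scale d j * Zt \<omega> j) =
      cg_scale d j * B * (prob (ev Cp) - prob (ev Cm))"
    by simp
  also have "\<dots> = expectation (\<lambda>\<omega>. cg_scale d j * B *
      (real_cond_exp M F (indicator (ev Cp)) \<omega> - real_cond_exp M F (indicator (ev Cm)) \<omega>))"
    using ce[OF C(2)] ce[OF C(3)] by simp
  also have "\<dots> = expectation (\<lambda>\<omega>. ?G (X \<omega>, Y \<omega>))"
  proof (intro integral_cong_AE)
    show "AE \<omega> in M. cg_scale d j * B *
        (real_cond_exp M F (indicator (ev Cp)) \<omega> - real_cond_exp M F (indicator (ev Cm)) \<omega>)
        = ?G (X \<omega>, Y \<omega>)"
      using AE_ce[OF C(2)] AE_ce[OF C(3)]
    proof eventually_elim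
      case (elim \<omega>)
      have sgn: "xi \<omega> j = sign_pm (X \<omega> j)"
        using j by (simp add: xi_def)
      note bias = half_cube_bias(2)[where x = "xi \<omega>" and y = "Y \<omega>", OF j d \<alpha> xi, unfolded sgn]
      show ?case
        unfolding elim prod.case unfolding Cp_def Cm_def B_def \<kappa>_def
        by (rule bias)
    qed
  qed measurable
  also have "\<dots> = integral\<^sup>L (distr M (Rvec d \<Otimes>\<^sub>M count_space UNIV) (\<lambda>\<omega>. (X \<omega>, Y \<omega>))) ?G"
    by (intro integral_distr[symmetric]) measurable
  also have "\<dots> = integral\<^sup>L (distr M (Rvec d) X) (\<lambda>x. sign_pm (x j))"
  proof -
    let ?D = "distr M (Rvec d) X" and ?b = "measure_pmf (bernoulli_pmf (exp \<alpha> / (exp \<alpha> + 1)))"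
    interpret D: prob_space ?D
      by (rule prob_space_distr) measurable
    interpret P: pair_prob_space ?D ?b
      by unfold_locales
    have "?G \<in> borel_measurable (?D \<Otimes>\<^sub>M ?b)"
      using G unfolding measurable_cong_sets[OF
          sets_pair_measure_cong[OF sets_distr sets_measure_pmf_count_space] refl] .
    then have "integrable (?D \<Otimes>\<^sub>M ?b) ?G"
      by (intro P.P.integrable_const_bound[where B = "\<bar>\<kappa>\<bar>"]) (auto simp: sign_pm_def abs_mult)
    then have "integral\<^sup>L (?D \<Otimes>\<^sub>M ?b) ?G = (\<integral>x. (\<integral>y. ?G (x, y) \<partial>?b) \<partial>?D)"
      by (rule P.integral_fst'[symmetric])
    also have "\<dots> = integral\<^sup>L ?D (\<lambda>x. sign_pm (x j))"
    proof (rule Bochner_Integration.integral_cong[OF refl])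
      fix x
      \<comment> \<open>The coin contributes the mean sign
        \<open>q - (1 - q) = (exp \<alpha> - 1) / (exp \<alpha> + 1)\<close>, the reciprocal of
        \<open>\<kappa>\<close>.\<close>
      define q where "q = exp \<alpha> / (exp \<alpha> + 1)"
      have "exp \<alpha> > 1" "exp \<alpha> + 1 > 0"
        using \<alpha> by (auto simp: add_pos_pos)
      then have q: "0 \<le> q" "q \<le> 1" and "\<kappa> * (q - (1 - q)) = 1"
        by (auto simp: q_def \<kappa>_def divide_simps)
      moreover have "(\<integral>y. ?G (x, y) \<partial>?b) = sign_pm (x j) * (\<kappa> * (q - (1 - q)))"
        unfolding q_def[symmetric] using q by (simp add: algebra_simps)
      ultimately show "(\<integral>y. ?G (x, y) \<partial>?b) = sign_pm (x j)"
        by simp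
    qed
    finally show ?thesis
      unfolding indep .
  qed
  also have "\<dots> = expectation (\<lambda>\<omega>. sign_pm (X \<omega> j))"
    by (intro integral_distr) measurable
  finally show "expectation (\<lambda>\<omega>. cg_scale d j * Zt \<omega> j) = expectation (\<lambda>\<omega>. sign_pm (X \<omega> j))" .
qed


subsection \<open>The mean sign of a shifted log-concave variable\<close>

text \<open>The point \<open>x\<close> lies between \<open>- y\<close> and \<open>y\<close>, where
  the even convex exponent takes the same value, so convexity bounds it at \<open>x\<close> by its
  value at \<open>y\<close>. The Gaussian factor is monotone in the absolute value as well.\<close>

lemma strongly_log_concave_ge:
  assumes "strongly_log_concave c p" "\<bar>x\<bar> \<le> y"
  shows "p y \<le> p x"
proof (cases "y = 0")
  case False
  obtain f where c: "c > 0" and f: "convex_on UNIV f" "\<And>x. f (- x) = f x"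
    and p: "\<And>x. p x = exp (- f x) * exp (- c * x\<^sup>2 / 2)"
    using assms by (auto simp: strongly_log_concave_def)
  \<comment> \<open>The weight that represents \<open>x\<close> as a convex combination of
    \<open>- y\<close> and \<open>y\<close>.\<close>
  define t where "t = (y + x) / (2 * y)"
  have y: "y > 0"
    using assms False by auto
  have t: "0 \<le> t" "t \<le> 1"
    using assms y by (auto simp: t_def divide_simps)
  have "f ((1 - t) *\<^sub>R (- y) + t *\<^sub>R y) \<le> (1 - t) * f (- y) + t * f y"
    by (rule convex_onD[OF f(1)]) (use t in auto)
  also have "\<dots> = f y"
    by (simp add: f(2) algebra_simps)
  also have "(1 - t) *\<^sub>R (- y) + t *\<^sub>R y = x"
    using y by (simp add: t_def field_simps)
  finally have "exp (- f y) \<le> exp (- f x)"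
    by simp
  moreover have "c * x\<^sup>2 \<le> c * y\<^sup>2"
    using c assms(2) by (intro mult_left_mono) (auto simp: abs_le_square_iff[symmetric])
  then have "exp (- c * y\<^sup>2 / 2) \<le> exp (- c * x\<^sup>2 / 2)"
    by simp
  ultimately show ?thesis
    unfolding p by (intro mult_mono) auto
qed (use assms in auto)

lemma strongly_log_concave_nonneg:
  "strongly_log_concave c p \<Longrightarrow> p x \<ge> 0"
  by (auto simp: strongly_log_concave_def)

text \<open>The sign is negative exactly when the noise is below \<open>- t / \<sigma>\<close>. By
  symmetry this left tail cancels the right tail beyond \<open>t / \<sigma>\<close>, and only the
  central interval contributes.\<close>

lemma (in prob_space) expectation_sign_noise:
  assumes noise: "noise_density c p" and dist: "distributed M lborel \<xi> (\<lambda>x. ennreal (p x))"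
    and "\<sigma> > 0" "t \<ge> 0"
  shows "expectation (\<lambda>\<omega>. sign_pm (t + \<sigma> * \<xi> \<omega>)) =
    measure (density lborel (\<lambda>x. ennreal (p x))) {- (t / \<sigma>)..t / \<sigma>}"
proof -
  define \<mu> where "\<mu> = density lborel (\<lambda>x. ennreal (p x))"
  define u where "u = t / \<sigma>"
  have u: "u \<ge> 0"
    using assms by (simp add: u_def)
  interpret \<mu>: prob_space \<mu>
    using noise by (simp add: noise_density_def Let_def \<mu>_def)
  have sets_\<mu> [measurable_cong]: "sets \<mu> = sets borel"
    by (simp add: \<mu>_def)
  have [measurable]: "\<xi> \<in> M \<rightarrow>\<^sub>M lborel"
    using dist by (rule distributed_measurable)
  have sym: "measure \<mu> {u<..} = measure \<mu> {..<- u}"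
  proof -
    have "distr \<mu> borel (\<lambda>x. - x) = \<mu>"
      using noise by (simp add: noise_density_def Let_def \<mu>_def)
    then have "measure \<mu> {u<..} = measure (distr \<mu> borel (\<lambda>x. - x)) {u<..}"
      by simp
    also have "\<dots> = measure \<mu> ((\<lambda>x. - x) -` {u<..} \<inter> space \<mu>)"
      by (rule measure_distr) measurable
    also have "(\<lambda>x. - x) -` {u<..} \<inter> space \<mu> = {..<- u}"
      using sets_eq_imp_space_eq[OF sets_\<mu>] by auto
    finally show ?thesis .
  qed
  have "expectation (\<lambda>\<omega>. sign_pm (t + \<sigma> * \<xi> \<omega>)) = integral\<^sup>L (distr M lborel \<xi>) (\<lambda>x. sign_pm (t + \<sigma> * x))"
    by (rule integral_distr[symmetric]) measurable
  also have "distr M lborel \<xi> = \<mu>"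
    using dist by (simp add: distributed_def \<mu>_def)
  also have "integral\<^sup>L \<mu> (\<lambda>x. sign_pm (t + \<sigma> * x)) =
      integral\<^sup>L \<mu> (\<lambda>x. indicator {- u..u} x + (indicator {u<..} x - indicator {..<- u} x))"
  proof (intro Bochner_Integration.integral_cong refl)
    fix x :: real
    have "t + \<sigma> * x \<ge> 0 \<longleftrightarrow> x \<ge> - u"
      using assms by (auto simp: u_def field_simps)
    then show "sign_pm (t + \<sigma> * x) = indicator {- u..u} x + (indicator {u<..} x - indicator {..<- u} x)"
      using u by (auto simp: sign_pm_def indicator_def)
  qed
  also have "\<dots> = measure \<mu> {- u..u} + (measure \<mu> {u<..} - measure \<mu> {..<- u})"
    using sets_eq_imp_space_eq[OF sets_\<mu>]
    by (subst Bochner_Integration.integral_add Bochner_Integration.integral_diff;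
        (simp add: \<mu>.emeasure_eq_measure sets_\<mu>)?)+
  finally show ?thesis
    using sym by (simp add: \<mu>_def u_def)
qed

text \<open>At \<open>t = 0\<close> the central interval shrinks to the point 0, which a law with a
  density does not charge; the convention \<open>sign_pm 0 = 1\<close> therefore causes no
  bias.\<close>

lemma (in prob_space) expectation_sign_noise_zero:
  assumes "noise_density c p" "distributed M lborel \<xi> (\<lambda>x. ennreal (p x))" "\<sigma> > 0"
  shows "expectation (\<lambda>\<omega>. sign_pm (0 + \<sigma> * \<xi> \<omega>)) = 0"
proof -
  have [measurable]: "(\<lambda>x. ennreal (p x)) \<in> borel_measurable lborel"
    using assms(2) by (rule distributed_borel_measurable)
  have "emeasure (density lborel (\<lambda>x. ennreal (p x))) {0} = 0"
    by (subst emeasure_density) (auto simp: nn_integral_0_iff_AE AE_lborel_singleton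
        intro!: eventually_mono[OF AE_lborel_singleton[of 0]])
  then show ?thesis
    using expectation_sign_noise[OF assms, of 0] by (simp add: measure_def)
qed

text \<open>The central interval contains the one from \<open>- a / \<sigma>\<close> to
  \<open>a / \<sigma>\<close>, of length \<open>2 * a / \<sigma>\<close>. The latter lies within
  distance 2 of 0, where the density is at least \<open>p 2\<close>.\<close>

lemma (in prob_space) expectation_sign_noise_ge:
  assumes noise: "noise_density c p" and dist: "distributed M lborel \<xi> (\<lambda>x. ennreal (p x))"
    and "\<sigma> > 0" "a > 0" "a \<le> 2 * \<sigma>" "a \<le> t"
  shows "2 * p 2 * a / \<sigma> \<le> expectation (\<lambda>\<omega>. sign_pm (t + \<sigma> * \<xi> \<omega>))"
proof -
  define \<mu> where "\<mu> = density lborel (\<lambda>x. ennreal (p x))"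
  define v where "v = a / \<sigma>"
  have v: "0 \<le> v" "v \<le> 2" "v \<le> t / \<sigma>"
    using assms by (auto simp: v_def divide_right_mono field_simps)
  interpret \<mu>: prob_space \<mu>
    using noise by (simp add: noise_density_def Let_def \<mu>_def)
  have slc: "strongly_log_concave c p"
    using noise by (simp add: noise_density_def Let_def)
  have [measurable]: "(\<lambda>x. ennreal (p x)) \<in> borel_measurable lborel"
    using dist by (rule distributed_borel_measurable)
  have "ennreal (p 2 * (2 * v)) = ennreal (p 2) * emeasure lborel {- v..v}"
    using v strongly_log_concave_nonneg[OF slc] by (simp add: ennreal_mult)
  also have "\<dots> = (\<integral>\<^sup>+x. ennreal (p 2) * indicator {- v..v} x \<partial>lborel)"
    by (simp add: nn_integral_cmult_indicator)
  also have "\<dots> \<le> (\<integral>\<^sup>+x. ennreal (p x) * indicator {- (t / \<sigma>)..t / \<sigma>} x \<partial>lborel)"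
    using v strongly_log_concave_ge[OF slc, of _ 2]
    by (intro nn_integral_mono) (auto simp: indicator_def intro!: ennreal_leI)
  also have "\<dots> = emeasure \<mu> {- (t / \<sigma>)..t / \<sigma>}"
    unfolding \<mu>_def by (subst emeasure_density) auto
  finally have "p 2 * (2 * v) \<le> measure \<mu> {- (t / \<sigma>)..t / \<sigma>}"
    by (simp add: \<mu>.emeasure_eq_measure)
  then show ?thesis
    using expectation_sign_noise[OF noise dist, of \<sigma> t] assms by (simp add: v_def \<mu>_def mult_ac)
qed

section \<open>Hoeffding bounds for means of bounded variables\<close>

lemma (in prob_space)
  fixes W :: "nat \<Rightarrow> 'a \<Rightarrow> real"
  assumes indep: "indep_vars (\<lambda>_. borel) W {1..n}" and n: "n \<ge> 1" and B: "B > 0"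
    and bounded: "\<And>i. i \<in> {1..n} \<Longrightarrow> AE \<omega> in M. W i \<omega> \<in> {- B..B}"
  shows prob_mean_ge: "(\<And>i. i \<in> {1..n} \<Longrightarrow> expectation (W i) = 0) \<Longrightarrow> \<tau> \<ge> 0 \<Longrightarrow>
      prob {\<omega> \<in> space M. \<tau> \<le> 1 / real n * (\<Sum>i=1..n. W i \<omega>)} \<le> exp (- (real n * \<tau>\<^sup>2 / (2 * B\<^sup>2)))"
    and prob_mean_less: "(\<And>i. i \<in> {1..n} \<Longrightarrow> \<delta> \<le> expectation (W i)) \<Longrightarrow> \<tau> < \<delta> \<Longrightarrow>
      prob {\<omega> \<in> space M. 1 / real n * (\<Sum>i=1..n. W i \<omega>) < \<tau>} \<le>
        exp (- (real n * (\<delta> - \<tau>)\<^sup>2 / (2 * B\<^sup>2)))"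
proof -
  interpret W: Hoeffding_ineq M "{1..n}" W "\<lambda>_. - B" "\<lambda>_. B" "\<Sum>i=1..n. expectation (W i)"
    by unfold_locales (use indep bounded in auto)
  have [measurable]: "i \<in> {1..n} \<Longrightarrow> W i \<in> borel_measurable M" for i
    by (rule W.random_variable)
  have len: "(\<Sum>i=1..n. (B - - B)\<^sup>2) = real n * (2 * B)\<^sup>2"
    by simp
  have pos: "real n * (2 * B)\<^sup>2 > 0"
    using n B by simp
  \<comment> \<open>A deviation of the mean by \<open>r\<close> is a deviation of the sum by
    \<open>n * r\<close>, and every summand ranges over an interval of length
    \<open>2 * B\<close>.\<close>
  have exponent: "- 2 * (real n * r)\<^sup>2 / (real n * (2 * B)\<^sup>2) = - (real n * r\<^sup>2 / (2 * B\<^sup>2))" for r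
    using n B by (simp add: power2_eq_square field_simps)
  show "prob {\<omega> \<in> space M. \<tau> \<le> 1 / real n * (\<Sum>i=1..n. W i \<omega>)} \<le> exp (- (real n * \<tau>\<^sup>2 / (2 * B\<^sup>2)))"
    if "\<And>i. i \<in> {1..n} \<Longrightarrow> expectation (W i) = 0" "\<tau> \<ge> 0"
  proof -
    have "{\<omega> \<in> space M. \<tau> \<le> 1 / real n * (\<Sum>i=1..n. W i \<omega>)} =
        {\<omega> \<in> space M. (\<Sum>i=1..n. expectation (W i)) + real n * \<tau> \<le> (\<Sum>i=1..n. W i \<omega>)}"
      using that(1) n by (auto simp: field_simps)
    then show ?thesis
      using W.Hoeffding_ineq_ge[of "real n * \<tau>"] that(2) pos unfolding len exponent by simp
  qed
  show "prob {\<omega> \<in> space M. 1 / real n * (\<Sum>i=1..n. W i \<omega>) < \<tau>} \<le>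
      exp (- (real n * (\<delta> - \<tau>)\<^sup>2 / (2 * B\<^sup>2)))"
    if "\<And>i. i \<in> {1..n} \<Longrightarrow> \<delta> \<le> expectation (W i)" "\<tau> < \<delta>"
  proof -
    let ?m = "\<Sum>i=1..n. expectation (W i)"
    have "(\<Sum>i=1..n. \<delta>) \<le> ?m"
      by (intro sum_mono that)
    then have "real n * \<delta> \<le> ?m"
      by simp
    \<comment> \<open>Only a lower bound \<open>\<delta>\<close> for the means is known, so the
      event is enlarged to one measured from the true mean of the sum.\<close>
    then have "1 / real n * (\<Sum>i=1..n. W i \<omega>) < \<tau> \<Longrightarrow> (\<Sum>i=1..n. W i \<omega>) \<le> ?m - real n * (\<delta> - \<tau>)" for \<omega>
      using n by (simp add: field_simps)
    then have "prob {\<omega> \<in> space M. 1 / real n * (\<Sum>i=1..n. W i \<omega>) < \<tau>}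
        \<le> prob {\<omega> \<in> space M. (\<Sum>i=1..n. W i \<omega>) \<le> ?m - real n * (\<delta> - \<tau>)}"
      by (intro finite_measure_mono) auto
    also have "\<dots> \<le> exp (- (real n * (\<delta> - \<tau>)\<^sup>2 / (2 * B\<^sup>2)))"
      using W.Hoeffding_ineq_le[of "real n * (\<delta> - \<tau>)"] that(2) pos unfolding len exponent by simp
    finally show ?thesis .
  qed
qed


subsection \<open>The risk of the selector\<close>

theorem proposition3p4:
  fixes M :: "'w measure"
    and n d s :: nat
    and \<sigma> \<alpha> c a \<tau> :: real
    and p :: "real \<Rightarrow> real"
    and \<theta> :: "nat \<Rightarrow> real"
    and \<xi> :: "nat \<Rightarrow> nat \<Rightarrow> 'w \<Rightarrow> real"
    and Y :: "nat \<Rightarrow> 'w \<Rightarrow> bool"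
    and Zt :: "nat \<Rightarrow> 'w \<Rightarrow> nat \<Rightarrow> real"
  assumes "prob_space M"
    and "\<sigma> > 0" and "\<alpha> > 0" and "n \<ge> 1" and "1 \<le> s" and "s \<le> d"
    and "noise_density c p"
    and "iid_noise M n d p \<xi>"
    and "cg_mechanism M n d \<alpha> (observation d \<theta> \<sigma> \<xi>) Y Zt"
    and "a > 0" and "a \<le> 2 * \<sigma>"
    and "0 \<le> \<tau>" and "\<tau> < 2 * p 2 * a / \<sigma>"
    and "\<theta> \<in> Theta_plus d s a"
  shows "prob_space.expectation M
           (\<lambda>\<omega>. 1 / real s *
              hamming_loss d (selector_plus n \<tau> (\<lambda>i. cg_output d (Zt i \<omega>))) (support_indicator \<theta>))
         \<le> (real d - real (card (support d \<theta>))) / real s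
               * exp (- (real n * \<tau>\<^sup>2 / (2 * (cg_B \<alpha> d)\<^sup>2)))
           + real (card (support d \<theta>)) / real s
               * exp (- (real n * (2 * p 2 * a / \<sigma> - \<tau>)\<^sup>2 / (2 * (cg_B \<alpha> d)\<^sup>2)))"
proof -
  interpret prob_space M by fact
  define loss where "loss \<omega> = 1 / real s *
    hamming_loss d (selector_plus n \<tau> (\<lambda>i. cg_output d (Zt i \<omega>))) (support_indicator \<theta>)" for \<omega>
  define W where "W j i \<omega> = cg_scale d j * Zt i \<omega> j" for j i \<omega>
  \<comment> \<open>This covers both kinds of error: selecting a coordinate with \<theta> zero there
    and missing one in the support.\<close>
  define err where "err j = {\<omega> \<in> space M.
    (\<tau> \<le> 1 / real n * (\<Sum>i=1..n. W j i \<omega>)) \<noteq> (\<theta> j \<noteq> 0)}" for j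
  define b0 where "b0 = exp (- (real n * \<tau>\<^sup>2 / (2 * (cg_B \<alpha> d)\<^sup>2)))"
  define b1 where "b1 = exp (- (real n * (2 * p 2 * a / \<sigma> - \<tau>)\<^sup>2 / (2 * (cg_B \<alpha> d)\<^sup>2)))"
  have d: "d \<ge> 1" and s: "s > 0"
    using assms by auto
  have loss: "loss \<omega> = 1 / real s * (\<Sum>j=1..d. indicator (err j) \<omega>)" if "\<omega> \<in> space M" for \<omega>
    using that unfolding loss_def hamming_loss_def selector_plus_def support_indicator_def
      cg_output_eq W_def[symmetric]
    by (intro arg_cong2[where f = "(*)"] sum.cong refl) (auto simp: err_def indicator_def)
  have "expectation loss \<le> (real d - real (card (support d \<theta>))) / real s * b0
      + real (card (support d \<theta>)) / real s * b1"
  proof (cases "d = 2")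
    case True
    \<comment> \<open>The closed form of \<open>1 / K\<^sub>d\<close> vanishes here, so division by
      0 makes \<open>cg_K\<close> zero, and then also both exponents.\<close>
    then have "cg_B \<alpha> d = 0"
      by (simp add: cg_B_def cg_K_def)
    then have rhs: "b0 = 1" "b1 = 1"
      by (simp_all add: b0_def b1_def)
    have "loss \<omega> \<le> real d / real s" if "\<omega> \<in> space M" for \<omega>
    proof -
      have "(\<Sum>j=1..d. indicator (err j) \<omega>) \<le> (\<Sum>j=1..d. 1 :: real)"
        by (intro sum_mono) (auto simp: indicator_def)
      then show ?thesis
        using s unfolding loss[OF that] by (simp add: divide_right_mono)
    qed
    then have "expectation loss \<le> real d / real s"
      \<comment> \<open>Without integrability the Bochner integral is 0 by default, which is still
        below the nonnegative bound.\<close>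
      by (cases "integrable M loss") (auto intro!: integral_le_const simp: not_integrable_integral_eq)
    then show ?thesis
      by (simp add: rhs add_divide_distrib[symmetric])
  next
    case False
    let ?X = "observation d \<theta> \<sigma> \<xi>"
    have B: "cg_B \<alpha> d > 0"
      by (rule cg_B_pos) fact+
    have indep: "indep_vars (\<lambda>_. Rvec d \<Otimes>\<^sub>M (count_space UNIV \<Otimes>\<^sub>M Rvec d))
        (\<lambda>i \<omega>. (?X i \<omega>, Y i \<omega>, Zt i \<omega>)) {1..n}"
      using assms(9) by (simp add: cg_mechanism_def)
    have W_indep: "indep_vars (\<lambda>_. borel) (W j) {1..n}" if "j \<in> {1..d}" for j
    proof -
      have [measurable]: "(\<lambda>z. z j) \<in> borel_measurable (Rvec d)"
        using that by (rule measurable_component_singleton)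
      \<comment> \<open>For fixed \<open>j\<close> the same function is applied to independent
        triples. Coordinates of one privatized vector need not be independent, so each
        \<open>j\<close> is treated separately and the losses are added by linearity.\<close>
      have "(\<lambda>(x, y, z). cg_scale d j * z j) \<in>
          borel_measurable (Rvec d \<Otimes>\<^sub>M ((count_space UNIV :: bool measure) \<Otimes>\<^sub>M Rvec d))"
        by measurable
      from indep_vars_compose2[OF indep this] show ?thesis
        by (simp add: W_def[abs_def])
    qed
    have coordinate: "AE \<omega> in M. Zt i \<omega> j \<in> {- cg_B \<alpha> d, cg_B \<alpha> d}"
      "expectation (W j i) = expectation (\<lambda>\<omega>. sign_pm (\<theta> j + \<sigma> * \<xi> i j \<omega>))"
      if "i \<in> {1..n}" "j \<in> {1..d}" for i j
    proof -
      have XYZ: "(\<lambda>\<omega>. (?X i \<omega>, Y i \<omega>, Zt i \<omega>)) \<in> M \<rightarrow>\<^sub>M Rvec d \<Otimes>\<^sub>M (count_space UNIV \<Otimes>\<^sub>M Rvec d)"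
        using indep that(1) by (simp add: indep_vars_def)
      have meas: "?X i \<in> M \<rightarrow>\<^sub>M Rvec d" "Y i \<in> M \<rightarrow>\<^sub>M count_space UNIV" "Zt i \<in> M \<rightarrow>\<^sub>M Rvec d"
        using measurable_compose[OF XYZ measurable_fst]
          measurable_compose[OF measurable_compose[OF XYZ measurable_snd] measurable_fst]
          measurable_compose[OF measurable_compose[OF XYZ measurable_snd] measurable_snd]
        by simp_all
      note mech = assms(9)[unfolded cg_mechanism_def, THEN conjunct2, rule_format, OF that(1)]
      show "AE \<omega> in M. Zt i \<omega> j \<in> {- cg_B \<alpha> d, cg_B \<alpha> d}"
        by (rule cg_mechanism_coordinate(1)[OF meas]) (use mech that False assms in auto)
      have "expectation (W j i) = expectation (\<lambda>\<omega>. sign_pm (?X i \<omega> j))"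
        unfolding W_def
        by (rule cg_mechanism_coordinate(2)[OF meas]) (use mech that False assms in auto)
      also have "\<dots> = expectation (\<lambda>\<omega>. sign_pm (\<theta> j + \<sigma> * \<xi> i j \<omega>))"
        using that by (simp add: observation_def)
      finally show "expectation (W j i) = expectation (\<lambda>\<omega>. sign_pm (\<theta> j + \<sigma> * \<xi> i j \<omega>))" .
    qed
    have W_bounded: "AE \<omega> in M. W j i \<omega> \<in> {- cg_B \<alpha> d..cg_B \<alpha> d}" if "i \<in> {1..n}" "j \<in> {1..d}" for i j
      using coordinate(1)[OF that]
    proof eventually_elim
      case (elim \<omega>)
      have "\<bar>W j i \<omega>\<bar> = cg_scale d j * cg_B \<alpha> d"
        using elim B cg_scale_bounds(1)[OF d False, of j] by (auto simp: W_def abs_mult)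
      also have "\<dots> \<le> 1 * cg_B \<alpha> d"
        using B cg_scale_bounds(2)[OF d False, of j] by (intro mult_right_mono) auto
      finally show ?case
        by auto
    qed
    have dist: "distributed M lborel (\<xi> i j) (\<lambda>x. ennreal (p x))" if "i \<in> {1..n}" "j \<in> {1..d}" for i j
      using assms(8) that by (simp add: iid_noise_def)
    have [measurable]: "W j i \<in> borel_measurable M" if "i \<in> {1..n}" "j \<in> {1..d}" for i j
      using W_indep[OF that(2)] that(1) by (simp add: indep_vars_def)
    have err [measurable]: "err j \<in> events" if "j \<in> {1..d}" for j
      unfolding err_def using that by measurable
    have prob_err: "prob (err j) \<le> (if j \<in> support d \<theta> then b1 else b0)" if j: "j \<in> {1..d}" for j
    proof (cases "\<theta> j = 0")
      case True
      have "expectation (W j i) = 0" if "i \<in> {1..n}" for i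
        using expectation_sign_noise_zero[OF assms(7) dist[OF that j] \<open>\<sigma> > 0\<close>]
        by (simp add: coordinate(2)[OF that j] True)
      \<comment> \<open>The sign of \<tau> matters here: for a negative threshold the event would
        contain the mean 0, and its probability would tend to 1 as \<open>n\<close> grows.\<close>
      then show ?thesis
        using prob_mean_ge[OF W_indep[OF j] \<open>n \<ge> 1\<close> B W_bounded[OF _ j] _ \<open>0 \<le> \<tau>\<close>] True
        by (simp add: err_def support_def b0_def)
    next
      case nz: False
      \<comment> \<open>Coordinates outside the witness set in \<open>Theta_plus\<close> vanish, so
        \<open>j\<close> belongs to it.\<close>
      then have "a \<le> \<theta> j"
        using assms(14) j by (auto simp: Theta_plus_def)
      then have "2 * p 2 * a / \<sigma> \<le> expectation (W j i)" if "i \<in> {1..n}" for i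
        using expectation_sign_noise_ge[OF assms(7) dist[OF that j] \<open>\<sigma> > 0\<close> \<open>a > 0\<close> \<open>a \<le> 2 * \<sigma>\<close>]
        by (simp add: coordinate(2)[OF that j])
      then show ?thesis
        using prob_mean_less[OF W_indep[OF j] \<open>n \<ge> 1\<close> B W_bounded[OF _ j] _ assms(13)] nz j
        by (simp add: err_def support_def b1_def not_le)
    qed
    have "expectation loss = expectation (\<lambda>\<omega>. 1 / real s * (\<Sum>j=1..d. indicator (err j) \<omega>))"
      by (intro Bochner_Integration.integral_cong refl loss)
    also have "\<dots> = 1 / real s * (\<Sum>j=1..d. prob (err j))"
      using err by (simp add: Bochner_Integration.integral_sum emeasure_eq_measure)
    also have "\<dots> \<le> 1 / real s * (\<Sum>j=1..d. if j \<in> support d \<theta> then b1 else b0)"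
      by (intro mult_left_mono sum_mono prob_err) auto
    also have "(\<Sum>j=1..d. if j \<in> support d \<theta> then b1 else b0) =
        real (card (support d \<theta>)) * b1 + real (card ({1..d} - support d \<theta>)) * b0"
    proof -
      have "{1..d} \<inter> support d \<theta> = support d \<theta>" "{1..d} \<inter> - support d \<theta> = {1..d} - support d \<theta>"
        by (auto simp: support_def)
      then show ?thesis
        by (simp add: sum.If_cases)
    qed
    also have "real (card ({1..d} - support d \<theta>)) = real d - real (card (support d \<theta>))"
    proof -
      have "support d \<theta> \<subseteq> {1..d}"
        by (auto simp: support_def)
      then show ?thesis
        using card_mono[of "{1..d}" "support d \<theta>"]
        by (simp add: card_Diff_subset finite_subset[of _ "{1..d}"] of_nat_diff)
    qed
    finally show ?thesis
      using s by (simp add: field_simps)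
  qed
  then show ?thesis
    unfolding loss_def b0_def b1_def .
qed

end
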